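(* Let $J=\{1,\dots,r\}$ and for each $j\in J$ let $n_j\ge0$ be an integer, $A^j\in\mathbb{R}^{(n_j+1)\times n}$, $b^j\in\mathbb{R}^{n_j+1}$; let $c\in\mathbb{R}^n$. Consider the second-order cone program $$(P)\quad \min_{x\in\mathbb{R}^n} c^\top x\ \text{ s.t. } A^jx-b^j\in L_{n_j}\ \ \forall j\in J,$$ and its semidefinite programming representation $$(MP)\quad \min_{x\in\mathbb{R}^n} c^\top x\ \text{ s.t. } \operatorname{Arw}(A^jx-b^j)\in\mathbb{S}^{n_j+1}_+\ \ \forall j\in J.$$ Assume that strong duality holds for (P) and its dual. Then (P) and (MP) have the same four-partition and the same six-partition (as defined in the context).
   Context: Lorentz cones: $L_0=\mathbb{R}_+$, and $L_m=\{(s_0,\bar s)\in\mathbb{R}\times\mathbb{R}^m: s_0\ge\|\bar s\|\}$ for $m\ge1$. $\mathbb{S}^{m+1}$ is the space of real symmetric $(m+1)\times(m+1)$ matrices with inner product $X\cdot Y=\operatorname{Tr}(XY)$ and $\mathbb{S}^{m+1}_+$ its cone of positive semidefinite matrices. For $s=(s_0,\bar s)\in\mathbb{R}\times\mathbb{R}^m$, $$\operatorname{Arw}(s)=\begin{pmatrix} s_0&\bar s^\top\\ \bar s& s_0I_m\end{pmatrix}\in\mathbb{S}^{m+1}$$ ($\operatorname{Arw}(s)=s_0$ if $m=0$); its adjoint is $\operatorname{Arw}^\top Y=(\operatorname{Tr}Y,\,2\bar Y_0)$ for $Y=\begin{pmatrix}Y_{00}&\bar Y_0^\top\\ \bar Y_0&\bar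 Y\end{pmatrix}$. One has $s\in L_m$ iff $\operatorname{Arw}(s)\in\mathbb{S}^{m+1}_+$. General definitions. For closed convex regular cones (nonempty interior, pointed) $Q_j$ in Euclidean spaces $E_j$, linear maps $G^j:\mathbb{R}^n\to E_j$ with adjoints $(G^j)^\top$, and $g^j\in E_j$, $j\in J$, consider the problem $\min_x c^\top x$ s.t. $G^jx-g^j\in Q_j$ for all $j\in J$, with dual $\max_y\sum_j\langle g^j,y^j\rangle$ s.t. $\sum_j(G^j)^\top y^j=c$, $y^j\in Q_j^+$ for all $j\in J$, where $Q_j^+=\{y:\langle y,z\rangle\ge0\ \forall z\in Q_j\}$. Strong duality means that both optimal solution sets are nonempty and the duality gap is zero. Let $S$ be the set of $(x,y)$ with $G^jx-g^j\in Q_j$, $y^j\in Q_j^+$, $\langle y^j,G^jx-g^j\rangle=0$ for all $j\in J$ and $\sum_j(G^j)^\top y^j=c$. With $N_{Q}(s)=\{v:\langle v,z-s\rangle\le0\ \forall z\in Q\}$ for $s\in Q$, put $B=\{j:\exists(x,y)\in S,\ G^jx-g^j\in\operatorname{int}Q_j\}$, $N=\{j:\exists(x,y)\in S,\ y^j\in\operatorname{int}Q_j^+\}$, $R^0=\{j:\exists(x,y)\in S,\ -y^j\in\operatorname{ri}N_{Q_j}(G^jx-g^j)\}$, $R=R^0\setminus(B\cup N)$, $T=J\setminus R^0$, $B^0=\{j:y^j=0\ \forall(x,y)\in S\}$, $N^0=\{j:G^jx-g^j=0\ \forall(x,y)\in S\}$, $B'=B^0\setminus(N^0\cup B)$, $N'=N^0\setminus(B^0\cup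 N)$, $O=B^0\cap N^0$, $C=J\setminus(B^0\cup N^0)$. The four-partition is $(B,N,R,T)$ and the six-partition is $(B,N,B',N',O,C)$. For (P) take $Q_j=L_{n_j}$, $G^j=A^j$, $g^j=b^j$; for (MP) take $Q_j=\mathbb{S}^{n_j+1}_+$, $G^j=\operatorname{Arw}\circ A^j$, $g^j=\operatorname{Arw}(b^j)$. *)

theory Defs
  imports "HOL-Analysis.Analysis" "HOL-Library.Poly_Mapping"
begin

section \<open>Finitely supported families as an inner product space\<close>

text \<open>
  The blocks of a conic program live in Euclidean spaces whose dimensions depend on the block.
  All of them are realised as finite-dimensional subspaces of one inner product space, the
  finitely supported families \<^typ>\<open>'i \<Rightarrow>\<^sub>0 real\<close>, with
  index type \<^typ>\<open>nat\<close> for vectors and \<^typ>\<open>nat \<times> nat\<close> for matrices.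
  Interiors are taken relative to these subspaces.
\<close>

abbreviation keys :: "('i \<Rightarrow>\<^sub>0 'v::zero) \<Rightarrow> 'i set"
  where "keys \<equiv> Poly_Mapping.keys"

abbreviation lookup :: "('i \<Rightarrow>\<^sub>0 'v::zero) \<Rightarrow> 'i \<Rightarrow> 'v"
  where "lookup \<equiv> Poly_Mapping.lookup"

instantiation poly_mapping :: (type, real_inner) real_inner
begin

lift_definition scaleR_poly_mapping :: "real \<Rightarrow> ('a \<Rightarrow>\<^sub>0 'b) \<Rightarrow> ('a \<Rightarrow>\<^sub>0 'b)"
  is "\<lambda>r f i. r *\<^sub>R f i"
  by (rule finite_subset) auto

definition inner_poly_mapping :: "('a \<Rightarrow>\<^sub>0 'b) \<Rightarrow> ('a \<Rightarrow>\<^sub>0 'b) \<Rightarrow> real"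
  where "inner_poly_mapping f g = (\<Sum>i\<in>keys f. lookup f i \<bullet> lookup g i)"

definition norm_poly_mapping :: "('a \<Rightarrow>\<^sub>0 'b) \<Rightarrow> real"
  where "norm_poly_mapping f = sqrt (f \<bullet> f)"

definition sgn_poly_mapping :: "('a \<Rightarrow>\<^sub>0 'b) \<Rightarrow> ('a \<Rightarrow>\<^sub>0 'b)"
  where "sgn_poly_mapping f = inverse (norm f) *\<^sub>R f"

definition dist_poly_mapping :: "('a \<Rightarrow>\<^sub>0 'b) \<Rightarrow> ('a \<Rightarrow>\<^sub>0 'b) \<Rightarrow> real"
  where "dist_poly_mapping f g = norm (f - g)"

definition uniformity_poly_mapping :: "(('a \<Rightarrow>\<^sub>0 'b) \<times> ('a \<Rightarrow>\<^sub>0 'b)) filter"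
  where "uniformity_poly_mapping = (INF e\<in>{0<..}. principal {(f, g). dist f g < e})"

definition open_poly_mapping :: "('a \<Rightarrow>\<^sub>0 'b) set \<Rightarrow> bool"
  where "open_poly_mapping U \<longleftrightarrow>
    (\<forall>f\<in>U. eventually (\<lambda>(f', g). f' = f \<longrightarrow> g \<in> U) uniformity)"

lemma inner_poly_mapping_superset:
  fixes f g :: "'a \<Rightarrow>\<^sub>0 'b"
  assumes "finite A" "keys f \<inter> keys g \<subseteq> A"
  shows "f \<bullet> g = (\<Sum>i\<in>A. lookup f i \<bullet> lookup g i)"
proof -
  have "f \<bullet> g = (\<Sum>i\<in>keys f \<inter> keys g. lookup f i \<bullet> lookup g i)"
    unfolding inner_poly_mapping_def
    by (rule sum.mono_neutral_right) (auto simp: in_keys_iff)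
  also have "\<dots> = (\<Sum>i\<in>A. lookup f i \<bullet> lookup g i)"
    using assms by (intro sum.mono_neutral_left) (auto simp: in_keys_iff)
  finally show ?thesis .
qed

instance
proof
  fix f g h :: "'a \<Rightarrow>\<^sub>0 'b" and r s :: real
  show "r *\<^sub>R (f + g) = r *\<^sub>R f + r *\<^sub>R g"
    by (rule poly_mapping_eqI) (simp add: scaleR_poly_mapping.rep_eq lookup_add algebra_simps)
  show "(r + s) *\<^sub>R f = r *\<^sub>R f + s *\<^sub>R f"
    by (rule poly_mapping_eqI) (simp add: scaleR_poly_mapping.rep_eq lookup_add algebra_simps)
  show "r *\<^sub>R s *\<^sub>R f = (r * s) *\<^sub>R f" "1 *\<^sub>R f = f"
    by (rule poly_mapping_eqI, simp add: scaleR_poly_mapping.rep_eq)+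
  show "f \<bullet> g = g \<bullet> f"
    by (simp add: inner_poly_mapping_superset[of "keys f \<inter> keys g"] inner_commute)
  show "(f + g) \<bullet> h = f \<bullet> h + g \<bullet> h"
    by (simp add: inner_poly_mapping_superset[of "keys h"] lookup_add inner_add_left sum.distrib)
  show "r *\<^sub>R f \<bullet> g = r * (f \<bullet> g)"
    by (simp add: inner_poly_mapping_superset[of "keys g"] scaleR_poly_mapping.rep_eq sum_distrib_left)
  show "0 \<le> f \<bullet> f"
    by (simp add: inner_poly_mapping_def sum_nonneg)
  show "f \<bullet> f = 0 \<longleftrightarrow> f = 0"
    by (auto simp: inner_poly_mapping_def sum_nonneg_eq_0_iff in_keys_iff intro!: poly_mapping_eqI)
qed (simp_all add: norm_poly_mapping_def sgn_poly_mapping_def dist_poly_mapping_def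
      uniformity_poly_mapping_def open_poly_mapping_def)

end

definition tabulate :: "'i set \<Rightarrow> ('i \<Rightarrow> real) \<Rightarrow> ('i \<Rightarrow>\<^sub>0 real)"
  where "tabulate I f = (\<Sum>i\<in>I. Poly_Mapping.single i (f i))"

lemma lookup_tabulate:
  "finite I \<Longrightarrow> lookup (tabulate I f) i = (if i \<in> I then f i else 0)"
  by (simp add: tabulate_def lookup_sum lookup_single when_def)


section \<open>Conic programs and their partitions\<close>

text \<open>
  Minimise \<open>cost \<bullet> x\<close> subject to \<open>lin j x - rhs j \<in> cone_of j\<close> for all blocks \<open>j \<in> blocks\<close>,
  where \<open>cone_of j\<close> is a cone in the Euclidean space \<open>space_of j\<close>. Families \<open>y\<close> of dual
  variables are total functions; their values outside \<open>blocks\<close> are irrelevant.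
\<close>

record ('x, 'e) conic_program =
  blocks :: "nat set"
  space_of :: "nat \<Rightarrow> 'e set"
  cone_of :: "nat \<Rightarrow> 'e set"
  lin :: "nat \<Rightarrow> 'x \<Rightarrow> 'e"
  rhs :: "nat \<Rightarrow> 'e"
  cost :: 'x

definition dual_cone :: "'e::real_inner set \<Rightarrow> 'e set \<Rightarrow> 'e set"
  where "dual_cone E Q = {y\<in>E. \<forall>z\<in>Q. 0 \<le> y \<bullet> z}"

definition normal_cone :: "'e::real_inner set \<Rightarrow> 'e set \<Rightarrow> 'e \<Rightarrow> 'e set"
  where "normal_cone E Q s = {v\<in>E. \<forall>z\<in>Q. v \<bullet> (z - s) \<le> 0}"

definition int_in :: "'e::topological_space set \<Rightarrow> 'e set \<Rightarrow> 'e set"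
  where "int_in E Q = (top_of_set E) interior_of Q"

text \<open>
  \<^const>\<open>adjoint\<close> is meaningful for every linear map out of a Euclidean space; the codomain
  need not be finite-dimensional.
\<close>

lemma adjoint_eq_Basis_sum:
  fixes f :: "'x::euclidean_space \<Rightarrow> 'e::real_inner"
  assumes "linear f"
  shows "adjoint f y = (\<Sum>i\<in>Basis. (f i \<bullet> y) *\<^sub>R i)"
proof -
  have "f x \<bullet> y = x \<bullet> (\<Sum>i\<in>Basis. (f i \<bullet> y) *\<^sub>R i)" for x y
  proof -
    have "f x = f (\<Sum>i\<in>Basis. (x \<bullet> i) *\<^sub>R i)"
      by (simp add: euclidean_representation)
    also have "\<dots> = (\<Sum>i\<in>Basis. (x \<bullet> i) *\<^sub>R f i)"
      by (simp add: linear_sum[OF assms] linear_scale[OF assms])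
    finally show ?thesis
      by (simp add: inner_sum_left inner_sum_right mult.commute)
  qed
  then show ?thesis
    using adjoint_unique[of f "\<lambda>y. \<Sum>i\<in>Basis. (f i \<bullet> y) *\<^sub>R i"] by metis
qed

context
  fixes P :: "('x::real_inner, 'e::real_inner) conic_program"
begin

definition slack :: "nat \<Rightarrow> 'x \<Rightarrow> 'e"
  where "slack j x = lin P j x - rhs P j"

definition primal_feasible :: "'x set"
  where "primal_feasible = {x. \<forall>j\<in>blocks P. slack j x \<in> cone_of P j}"

definition dual_feasible :: "(nat \<Rightarrow> 'e) set"
  where "dual_feasible =
    {y. (\<Sum>j\<in>blocks P. adjoint (lin P j) (y j)) = cost P \<and>
        (\<forall>j\<in>blocks P. y j \<in> dual_cone (space_of P j) (cone_of P j))}"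

definition dual_value :: "(nat \<Rightarrow> 'e) \<Rightarrow> real"
  where "dual_value y = (\<Sum>j\<in>blocks P. rhs P j \<bullet> y j)"

definition primal_optimal :: "'x set"
  where "primal_optimal =
    {x\<in>primal_feasible. \<forall>x'\<in>primal_feasible. cost P \<bullet> x \<le> cost P \<bullet> x'}"

definition dual_optimal :: "(nat \<Rightarrow> 'e) set"
  where "dual_optimal =
    {y\<in>dual_feasible. \<forall>y'\<in>dual_feasible. dual_value y' \<le> dual_value y}"

definition strong_duality :: bool
  where "strong_duality \<longleftrightarrow>
    primal_optimal \<noteq> {} \<and> dual_optimal \<noteq> {} \<and>
    (\<forall>x\<in>primal_optimal. \<forall>y\<in>dual_optimal. cost P \<bullet> x = dual_value y)"

definition compl_solutions :: "('x \<times> (nat \<Rightarrow> 'e)) set"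
  where "compl_solutions =
    {(x, y). (\<forall>j\<in>blocks P. slack j x \<in> cone_of P j \<and>
                y j \<in> dual_cone (space_of P j) (cone_of P j) \<and> y j \<bullet> slack j x = 0) \<and>
             (\<Sum>j\<in>blocks P. adjoint (lin P j) (y j)) = cost P}"

definition part_B :: "nat set"
  where "part_B = {j\<in>blocks P. \<exists>(x, y)\<in>compl_solutions.
    slack j x \<in> int_in (space_of P j) (cone_of P j)}"

definition part_N :: "nat set"
  where "part_N = {j\<in>blocks P. \<exists>(x, y)\<in>compl_solutions.
    y j \<in> int_in (space_of P j) (dual_cone (space_of P j) (cone_of P j))}"

definition part_R0 :: "nat set"
  where "part_R0 = {j\<in>blocks P. \<exists>(x, y)\<in>compl_solutions.
    - y j \<in> rel_interior (normal_cone (space_of P j) (cone_of P j) (slack j x))}"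

definition part_R :: "nat set"
  where "part_R = part_R0 - (part_B \<union> part_N)"

definition part_T :: "nat set"
  where "part_T = blocks P - part_R0"

definition part_B0 :: "nat set"
  where "part_B0 = {j\<in>blocks P. \<forall>(x, y)\<in>compl_solutions. y j = 0}"

definition part_N0 :: "nat set"
  where "part_N0 = {j\<in>blocks P. \<forall>(x, y)\<in>compl_solutions. slack j x = 0}"

definition part_B' :: "nat set"
  where "part_B' = part_B0 - (part_N0 \<union> part_B)"

definition part_N' :: "nat set"
  where "part_N' = part_N0 - (part_B0 \<union> part_N)"

definition part_O :: "nat set"
  where "part_O = part_B0 \<inter> part_N0"

definition part_C :: "nat set"
  where "part_C = blocks P - (part_B0 \<union> part_N0)"

definition four_partition :: "nat set \<times> nat set \<times> nat set \<times> nat set"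
  where "four_partition = (part_B, part_N, part_R, part_T)"

definition six_partition ::
    "nat set \<times> nat set \<times> nat set \<times> nat set \<times> nat set \<times> nat set"
  where "six_partition = (part_B, part_N, part_B', part_N', part_O, part_C)"

end


section \<open>Second-order cone programs and their semidefinite representation\<close>

text \<open>\<open>vec_space m\<close> is \<open>\<real> \<times> \<real>\<^sup>m\<close>: coordinate 0 is \<open>s\<^sub>0\<close>, coordinates \<open>1..m\<close> are the tail.\<close>

definition vec_space :: "nat \<Rightarrow> (nat \<Rightarrow>\<^sub>0 real) set"
  where "vec_space m = {s. keys s \<subseteq> {..m}}"

text \<open>For \<open>m = 0\<close> the tail is empty, so the Lorentz cone is the nonnegative half-line.\<close>

definition lorentz_cone :: "nat \<Rightarrow> (nat \<Rightarrow>\<^sub>0 real) set"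
  where "lorentz_cone m = {s\<in>vec_space m. L2_set (lookup s) {1..m} \<le> lookup s 0}"

text \<open>Symmetric matrices of size \<open>m + 1\<close>, with rows and columns indexed by \<open>0..m\<close>.\<close>

definition sym_space :: "nat \<Rightarrow> (nat \<times> nat \<Rightarrow>\<^sub>0 real) set"
  where "sym_space m = {X. keys X \<subseteq> {..m} \<times> {..m} \<and>
    (\<forall>i k. lookup X (i, k) = lookup X (k, i))}"

definition psd_cone :: "nat \<Rightarrow> (nat \<times> nat \<Rightarrow>\<^sub>0 real) set"
  where "psd_cone m = {X\<in>sym_space m.
    \<forall>v :: nat \<Rightarrow> real. 0 \<le> (\<Sum>i\<le>m. \<Sum>k\<le>m. v i * lookup X (i, k) * v k)}"

lemma subspace_vec_space: "subspace (vec_space m)"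
  by (auto simp: subspace_def vec_space_def in_keys_iff subset_iff lookup_add
      scaleR_poly_mapping.rep_eq) (metis add.right_neutral)

lemma subspace_sym_space: "subspace (sym_space m)"
  by (auto simp: subspace_def sym_space_def in_keys_iff subset_iff lookup_add
      scaleR_poly_mapping.rep_eq) (metis add.right_neutral)+

lemma inner_sym_space_eq_trace:
  assumes "X \<in> sym_space m" "Y \<in> sym_space m"
  shows "X \<bullet> Y = (\<Sum>i\<le>m. \<Sum>k\<le>m. lookup X (i, k) * lookup Y (k, i))"
proof -
  have "X \<bullet> Y = (\<Sum>p\<in>{..m} \<times> {..m}. lookup X p * lookup Y p)"
    using assms by (subst inner_poly_mapping_superset[of "{..m} \<times> {..m}"]) (auto simp: sym_space_def)
  also have "\<dots> = (\<Sum>i\<le>m. \<Sum>k\<le>m. lookup X (i, k) * lookup Y (i, k))"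
    by (simp add: sum.cartesian_product case_prod_unfold)
  also have "\<dots> = (\<Sum>i\<le>m. \<Sum>k\<le>m. lookup X (i, k) * lookup Y (k, i))"
    using assms(2) by (intro sum.cong refl) (auto simp: sym_space_def)
  finally show ?thesis .
qed

definition arw :: "nat \<Rightarrow> (nat \<Rightarrow>\<^sub>0 real) \<Rightarrow> (nat \<times> nat \<Rightarrow>\<^sub>0 real)"
  where "arw m s = tabulate ({..m} \<times> {..m})
    (\<lambda>(i, k). if i = k then lookup s 0
              else if i = 0 then lookup s k
              else if k = 0 then lookup s i
              else 0)"

text \<open>
  \<open>A j i\<close> is the \<open>i\<close>-th row of the matrix of block \<open>j\<close> and \<open>b j i\<close> the \<open>i\<close>-th entry of its
  right-hand side. Only the values with \<open>1 \<le> j \<le> r\<close> and \<open>i \<le> n j\<close> are used.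
\<close>

definition socp :: "nat \<Rightarrow> (nat \<Rightarrow> nat) \<Rightarrow> (nat \<Rightarrow> nat \<Rightarrow> real^'n) \<Rightarrow> (nat \<Rightarrow> nat \<Rightarrow> real)
    \<Rightarrow> real^'n \<Rightarrow> (real^'n, nat \<Rightarrow>\<^sub>0 real) conic_program"
  where "socp r n A b c =
    \<lparr>blocks = {1..r},
     space_of = (\<lambda>j. vec_space (n j)),
     cone_of = (\<lambda>j. lorentz_cone (n j)),
     lin = (\<lambda>j x. tabulate {..n j} (\<lambda>i. A j i \<bullet> x)),
     rhs = (\<lambda>j. tabulate {..n j} (b j)),
     cost = c\<rparr>"

definition socp_sdp :: "nat \<Rightarrow> (nat \<Rightarrow> nat) \<Rightarrow> (nat \<Rightarrow> nat \<Rightarrow> real^'n) \<Rightarrow> (nat \<Rightarrow> nat \<Rightarrow> real)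
    \<Rightarrow> real^'n \<Rightarrow> (real^'n, nat \<times> nat \<Rightarrow>\<^sub>0 real) conic_program"
  where "socp_sdp r n A b c =
    \<lparr>blocks = {1..r},
     space_of = (\<lambda>j. sym_space (n j)),
     cone_of = (\<lambda>j. psd_cone (n j)),
     lin = (\<lambda>j x. arw (n j) (lin (socp r n A b c) j x)),
     rhs = (\<lambda>j. arw (n j) (rhs (socp r n A b c) j)),
     cost = c\<rparr>"

lemma linear_lin_socp: "linear (lin (socp r n A b c) j)"
  by (rule linearI; rule poly_mapping_eqI)
    (simp_all add: socp_def lookup_tabulate lookup_add scaleR_poly_mapping.rep_eq inner_add_right)

lemma linear_arw: "linear (arw m)"
  by (rule linearI; rule poly_mapping_eqI)
    (auto simp: arw_def lookup_tabulate lookup_add scaleR_poly_mapping.rep_eq)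

lemma linear_lin_socp_sdp: "linear (lin (socp_sdp r n A b c) j)"
  using linear_compose[OF linear_lin_socp[of r n A b c j] linear_arw[of "n j"]]
  by (simp add: socp_sdp_def o_def)

end

theory Submission
  imports Defs
begin

text \<open>
  Write \<open>Arw\<^sup>T\<close> for the adjoint \<open>arw_adj\<close> of the arrow map. A slack \<open>s\<close> of the second-order cone
  program corresponds to the slack \<open>Arw s\<close> of the semidefinite program, and a matrix multiplier
  \<open>Y\<close> is feasible and complementary to \<open>Arw s\<close> exactly if \<open>Arw\<^sup>T Y\<close> is so for \<open>s\<close>, provided
  \<open>Y\<close> lies in the dual cone. Moreover \<open>Arw\<^sup>T\<close> maps the dual of the semidefinite cone onto the
  Lorentz cone (\<open>arw_adj_psd_dual\<close>), because every point of the Lorentz cone is the image of a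
  rank-one matrix (\<open>lorentz_cone_eq_outer\<close>). So the solutions of the two programs have the same
  \<open>x\<close>, and the matrix multipliers \<open>Y\<close> are precisely the blockwise
  lifts of the multipliers \<open>y\<close> to the dual cone.

  It remains to see that each defining property of the partitions holds for \<open>(s, y)\<close> if and only
  if it holds for \<open>(Arw s, Y)\<close> with some lift \<open>Y\<close> of \<open>y\<close> (\<open>ex_compl_solutions_transfer\<close>).
  Vanishing of the slack is clear, and \<open>Arw\<^sup>T Y = 0\<close> forces \<open>Y = 0\<close> since the trace of \<open>Y\<close>
  vanishes. Interiors are detected by subtracting a small multiple of the identity matrix,
  respectively of the axis vector of the Lorentz cone (\<open>int_in_dual_cone\<close>), and these correspond
  to each other under both \<open>Arw\<close> and \<open>Arw\<^sup>T\<close>. Finally, \<open>Arw\<^sup>T\<close> maps the normal cone at \<open>Arw s\<close>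
  onto the normal cone at \<open>s\<close>, and taking relative interiors commutes with linear images of
  finite-dimensional convex cones (\<open>rel_interior_linear_image_convex_cone\<close>); this settles the
  condition on the normal cones.
\<close>

section \<open>Convex cones in finite-dimensional subspaces\<close>

lemma orthogonal_expansion:
  fixes w :: "'a::real_inner"
  assumes "finite C" "pairwise orthogonal C" "w \<in> span C"
  shows "(\<Sum>c\<in>C. (w \<bullet> c / (c \<bullet> c)) *\<^sub>R c) = w"
proof -
  obtain u where u: "w = (\<Sum>c\<in>C. u c *\<^sub>R c)"
    using assms(3) by (auto simp: span_finite[OF assms(1)])
  have "w \<bullet> c = u c * (c \<bullet> c)" if "c \<in> C" for c
  proof -
    have "w \<bullet> c = (\<Sum>b\<in>C. if b = c then u c * (c \<bullet> c) else 0)"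
      unfolding u inner_sum_left using assms(2) that
      by (intro sum.cong) (auto simp: pairwise_def orthogonal_def)
    then show ?thesis
      using assms(1) that by simp
  qed
  then have "(w \<bullet> c / (c \<bullet> c)) *\<^sub>R c = u c *\<^sub>R c" if "c \<in> C" for c
    using that by (cases "c = 0") auto
  then have "(\<Sum>c\<in>C. (w \<bullet> c / (c \<bullet> c)) *\<^sub>R c) = (\<Sum>c\<in>C. u c *\<^sub>R c)"
    by (rule sum.cong[OF refl])
  then show ?thesis
    unfolding u[symmetric] .
qed

text \<open>
  Inclusion in the span of a finite set is how finite dimension is expressed throughout, the
  ambient space of finitely supported families being infinite-dimensional.
\<close>

lemma basis_in_convex_cone:
  assumes "K \<subseteq> span F" "finite F"
  obtains B where "B \<subseteq> K" "finite B" "span B = span K"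
proof -
  obtain B where B: "B \<subseteq> K" "independent B" "K \<subseteq> span B"
    using maximal_independent_subset by blast
  moreover have "finite B"
    using independent_span_bound[OF assms(2) B(2)] B(1) assms(1) by auto
  moreover have "span B = span K"
    using B by (metis span_eq span_superset subset_trans)
  ultimately show ?thesis
    using that by blast
qed

lemma span_convex_cone:
  assumes "convex_cone K" "w \<in> span K"
  obtains p q where "p \<in> K" "q \<in> K" "w = p - q"
proof -
  have K: "0 \<in> K" "\<And>x y. x \<in> K \<Longrightarrow> y \<in> K \<Longrightarrow> x + y \<in> K"
      "\<And>x c. x \<in> K \<Longrightarrow> 0 \<le> c \<Longrightarrow> c *\<^sub>R x \<in> K"
    using assms(1) by (auto simp: convex_cone_iff)
  have "subspace {p - q | p q. p \<in> K \<and> q \<in> K}"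
    unfolding subspace_def
  proof (intro conjI ballI allI)
    show "0 \<in> {p - q | p q. p \<in> K \<and> q \<in> K}"
      using K(1) by force
  next
    fix x y assume "x \<in> {p - q | p q. p \<in> K \<and> q \<in> K}" "y \<in> {p - q | p q. p \<in> K \<and> q \<in> K}"
    then obtain p q p' q' where "x = p - q" "y = p' - q'" "p \<in> K" "q \<in> K" "p' \<in> K" "q' \<in> K"
      by blast
    then have "x + y = (p + p') - (q + q')" "p + p' \<in> K" "q + q' \<in> K"
      using K(2) by auto
    then show "x + y \<in> {p - q | p q. p \<in> K \<and> q \<in> K}"
      by blast
  next
    fix c x assume "x \<in> {p - q | p q. p \<in> K \<and> q \<in> K}"
    then obtain p q where x: "x = p - q" "p \<in> K" "q \<in> K"
      by blast
    show "c *\<^sub>R x \<in> {p - q | p q. p \<in> K \<and> q \<in> K}"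
    proof (cases "0 \<le> c")
      case True
      then show ?thesis
        using x K(3) by (auto simp: scaleR_diff_right)
    next
      case False
      then have "c *\<^sub>R x = (- c) *\<^sub>R q - (- c) *\<^sub>R p" "(- c) *\<^sub>R q \<in> K" "(- c) *\<^sub>R p \<in> K"
        using x K(3)[of _ "- c"] by (auto simp: algebra_simps)
      then show ?thesis
        by blast
    qed
  qed
  moreover have "K \<subseteq> {p - q | p q. p \<in> K \<and> q \<in> K}"
    using K(1) by force
  ultimately have "w \<in> {p - q | p q. p \<in> K \<and> q \<in> K}"
    using assms(2) span_minimal by blast
  then show ?thesis
    using that by blast
qed

text \<open>
  In finite dimension, algebraic interior points of a convex cone are topological ones. From
  \<open>v\<close> one can move a little both ways along each vector of an orthogonal basis of the span;
  orthogonality bounds the coordinates of a short vector \<open>w\<close>, and \<open>v + w\<close> is then an average of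
  points obtained by moving along single basis vectors.
\<close>

lemma convex_cone_ball_from_rays:
  fixes K :: "'a::real_inner set"
  assumes K: "convex_cone K" and F: "K \<subseteq> span F" "finite F"
    and v: "v \<in> K" "\<And>w. w \<in> K \<Longrightarrow> \<exists>\<epsilon>>0. v - \<epsilon> *\<^sub>R w \<in> K"
  obtains \<delta> where "\<delta> > 0" "\<And>w. w \<in> span K \<Longrightarrow> norm w < \<delta> \<Longrightarrow> v + w \<in> K"
proof -
  note add = convex_cone_add[OF K] and scale = convex_cone_scaleR[OF K]
  obtain B where "B \<subseteq> K" and B: "finite B" "span B = span K"
    using basis_in_convex_cone[OF F] .
  obtain C where C: "finite C" "span C = span K" "pairwise orthogonal C"
    using basis_orthogonal[OF B(1)] unfolding B(2) by blast
  have ray: "\<exists>\<epsilon>>0. v + \<epsilon> *\<^sub>R w \<in> K" if "w \<in> span K" for w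
  proof -
    obtain p q where w: "p \<in> K" "q \<in> K" "w = p - q"
      using span_convex_cone[OF K \<open>w \<in> span K\<close>] .
    then obtain \<epsilon> where \<epsilon>: "\<epsilon> > 0" "v - \<epsilon> *\<^sub>R q \<in> K"
      using v(2) by blast
    then have "(v - \<epsilon> *\<^sub>R q) + \<epsilon> *\<^sub>R p \<in> K"
      using w(1) by (intro add scale) auto
    then show ?thesis
      using \<epsilon>(1) w(3) by (auto simp: algebra_simps)
  qed
  have "\<exists>a>0. \<forall>t. \<bar>t\<bar> \<le> a \<longrightarrow> v + t *\<^sub>R c \<in> K" if "c \<in> C" for c
  proof -
    have "c \<in> span K" "- c \<in> span K"
      using that C(2) span_base span_neg by blast+
    then obtain a1 a2 where a: "a1 > 0" "v + a1 *\<^sub>R c \<in> K" "a2 > 0" "v - a2 *\<^sub>R c \<in> K"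
      using ray[of c] ray[of "- c"] by auto
    have shrink: "v + (s * \<sigma>) *\<^sub>R c \<in> K" if "v + (a * \<sigma>) *\<^sub>R c \<in> K" "0 \<le> s" "s \<le> a" "0 < a" for s a \<sigma>
    proof -
      have "(1 - s / a) *\<^sub>R v + (s / a) *\<^sub>R (v + (a * \<sigma>) *\<^sub>R c) \<in> K"
        using that by (intro add[OF scale[OF _ v(1)] scale[OF _ that(1)]]) auto
      also have "(1 - s / a) *\<^sub>R v + (s / a) *\<^sub>R (v + (a * \<sigma>) *\<^sub>R c) = v + (s * \<sigma>) *\<^sub>R c"
        using that(4) by (simp add: algebra_simps)
      finally show ?thesis .
    qed
    have "v + t *\<^sub>R c \<in> K" if "\<bar>t\<bar> \<le> min a1 a2" for t
      using shrink[of a1 1 t] shrink[of a2 "-1" "- t"] a that by (cases "t \<ge> 0") auto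
    then show ?thesis
      using a by (intro exI[of _ "min a1 a2"]) auto
  qed
  then have "\<forall>c\<in>C. \<exists>a>0. \<forall>t. \<bar>t\<bar> \<le> a \<longrightarrow> v + t *\<^sub>R c \<in> K"
    by blast
  from bchoice[OF this] obtain a where a: "\<And>c. c \<in> C \<Longrightarrow> a c > 0"
      "\<And>c t. c \<in> C \<Longrightarrow> \<bar>t\<bar> \<le> a c \<Longrightarrow> v + t *\<^sub>R c \<in> K"
    by blast
  \<comment> \<open>Averaging over \<open>N\<close> basis vectors costs a factor \<open>N\<close> in each coordinate.\<close>
  define N where "N = real (card C)"
  define \<delta> where "\<delta> = Min (insert 1 ((\<lambda>c. a c * norm c / N) ` (C - {0})))"
  have N: "N > 0" if "c \<in> C" for c
    using that C(1) by (auto simp: N_def card_gt_0_iff)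
  have "\<delta> > 0"
    using C(1) a(1) N by (auto simp: \<delta>_def intro!: divide_pos_pos mult_pos_pos)
  moreover have "v + w \<in> K" if w: "w \<in> span K" "norm w < \<delta>" for w
  proof (cases "C = {}")
    case True
    then have "w \<in> {0}"
      using w(1) C(2) by simp
    then show ?thesis
      using v(1) by simp
  next
    case False
    then have "N > 0"
      using N by blast
    define t where "t c = w \<bullet> c / (c \<bullet> c)" for c
    have step: "v + (N * t c) *\<^sub>R c \<in> K" if c: "c \<in> C" for c
    proof (cases "c = 0")
      case True
      then show ?thesis using v(1) by simp
    next
      case False
      have "\<delta> \<le> a c * norm c / N"
        using C(1) c False by (auto simp: \<delta>_def intro: Min_le)
      then have "norm w \<le> a c * norm c / N"
        using w(2) by linarith
      then have le: "N * norm w \<le> a c * norm c"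
        using \<open>N > 0\<close> by (simp add: field_simps)
      have "\<bar>w \<bullet> c\<bar> \<le> norm w * norm c"
        by (rule Cauchy_Schwarz_ineq2)
      then have "N * \<bar>w \<bullet> c\<bar> \<le> N * norm w * norm c"
        using \<open>N > 0\<close> by simp
      also have "\<dots> \<le> (a c * norm c) * norm c"
        using le by (intro mult_right_mono) auto
      finally have "N * \<bar>w \<bullet> c\<bar> \<le> a c * (c \<bullet> c)"
        by (simp add: dot_square_norm power2_eq_square mult.assoc)
      then have "\<bar>N * t c\<bar> \<le> a c"
        using \<open>N > 0\<close> False by (simp add: t_def abs_mult field_simps)
      then show ?thesis
        using a(2) c by blast
    qed
    have comb: "(\<Sum>c\<in>S. (1 / N) *\<^sub>R (v + (N * t c) *\<^sub>R c)) \<in> K" if "S \<subseteq> C" for S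
      using finite_subset[OF that C(1)] that
    proof (induction S rule: finite_induct)
      case empty
      then show ?case using K by (simp add: convex_cone_iff)
    next
      case (insert c S)
      then show ?case
        using \<open>N > 0\<close> step[of c] by (auto simp del: scaleR_right_distrib intro!: add scale)
    qed
    from comb[of C] have "(\<Sum>c\<in>C. (1 / N) *\<^sub>R v + t c *\<^sub>R c) \<in> K"
      using \<open>N > 0\<close> by (simp add: scaleR_right_distrib)
    moreover have "(\<Sum>c\<in>C. (1 / N) *\<^sub>R v + t c *\<^sub>R c) = v + w"
      using orthogonal_expansion[OF C(1,3), of w] w(1) C(2) \<open>N > 0\<close>
      by (simp add: sum.distrib t_def sum_constant_scaleR N_def)
    ultimately show ?thesis
      by simp
  qed
  ultimately show ?thesis
    using that by blast
qed

lemma mem_rel_interior_convex_cone: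
  fixes K :: "'a::real_inner set"
  assumes K: "convex_cone K" and F: "K \<subseteq> span F" "finite F"
  shows "v \<in> rel_interior K \<longleftrightarrow> v \<in> K \<and> (\<forall>w\<in>K. \<exists>\<epsilon>>0. v - \<epsilon> *\<^sub>R w \<in> K)"
proof -
  have "0 \<in> K"
    using K by (simp add: convex_cone_iff)
  then have hull: "affine hull K = span K"
    by (intro affine_hull_span_0 hull_inc)
  show ?thesis
  proof safe
    assume "v \<in> rel_interior K"
    then obtain T where T: "open T" "v \<in> T" "v \<in> K" "T \<inter> span K \<subseteq> K"
      by (auto simp: mem_rel_interior hull)
    then show "v \<in> K" by blast
    fix w assume w: "w \<in> K"
    obtain d where d: "d > 0" "ball v d \<subseteq> T"
      using T(1,2) open_contains_ball by blast
    define \<epsilon> where "\<epsilon> = d / (1 + norm w)"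
    have "1 + norm w > 0"
      by (simp add: add_pos_nonneg)
    then have "\<epsilon> > 0" "\<epsilon> * norm w < d"
      using d(1) by (auto simp: \<epsilon>_def field_simps)
    then have "v - \<epsilon> *\<^sub>R w \<in> T"
      using d(2) by (auto simp: dist_norm subset_iff)
    moreover have "v - \<epsilon> *\<^sub>R w \<in> span K"
      using T(3) w by (intro span_diff span_scale span_base)
    ultimately show "\<exists>\<epsilon>>0. v - \<epsilon> *\<^sub>R w \<in> K"
      using T(4) \<open>\<epsilon> > 0\<close> by blast
  next
    assume v: "v \<in> K" "\<forall>w\<in>K. \<exists>\<epsilon>>0. v - \<epsilon> *\<^sub>R w \<in> K"
    then obtain \<delta> where \<delta>: "\<delta> > 0" "\<And>w. w \<in> span K \<Longrightarrow> norm w < \<delta> \<Longrightarrow> v + w \<in> K"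
      using convex_cone_ball_from_rays[OF K F, of v] by metis
    have "u \<in> K" if "u \<in> ball v \<delta>" "u \<in> span K" for u
      using \<delta>(2)[OF span_diff[OF that(2) span_base[OF v(1)]]] that(1)
      by (simp add: dist_norm norm_minus_commute)
    then show "v \<in> rel_interior K"
      unfolding mem_rel_interior hull using v(1) \<delta>(1) by (intro exI[of _ "ball v \<delta>"]) auto
  qed
qed

text \<open>
  The sum of a basis chosen inside the cone works: subtracting a small multiple of any vector
  keeps all its coordinates positive.
\<close>

lemma rel_interior_convex_cone_nonempty:
  fixes K :: "'a::real_inner set"
  assumes K: "convex_cone K" and F: "K \<subseteq> span F" "finite F"
  shows "rel_interior K \<noteq> {}"
proof -
  obtain B where B: "B \<subseteq> K" "finite B" "span B = span K"
    using basis_in_convex_cone[OF F] .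
  have comb: "(\<Sum>b\<in>S. u b *\<^sub>R b) \<in> K" if "S \<subseteq> B" "\<And>b. b \<in> S \<Longrightarrow> u b \<ge> 0" for S u
    using finite_subset[OF that(1) B(2)] that
    by (induction S rule: finite_induct) (use K B(1) in \<open>auto simp: convex_cone_iff\<close>)
  have "\<exists>\<epsilon>>0. \<Sum>B - \<epsilon> *\<^sub>R w \<in> K" if "w \<in> K" for w
  proof -
    obtain u where u: "w = (\<Sum>b\<in>B. u b *\<^sub>R b)"
      using span_base[OF \<open>w \<in> K\<close>] span_finite[OF B(2)] B(3) by auto
    define M where "M = 1 + (\<Sum>b\<in>B. \<bar>u b\<bar>)"
    have "M > 0"
      by (simp add: M_def add_pos_nonneg sum_nonneg)
    have "u b \<le> M" if "b \<in> B" for b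
      using member_le_sum[OF that, of "\<lambda>b. \<bar>u b\<bar>"] B(2) by (simp add: M_def)
    then have "(\<Sum>b\<in>B. (1 - u b / M) *\<^sub>R b) \<in> K"
      using \<open>M > 0\<close> by (intro comb) auto
    also have "(\<Sum>b\<in>B. (1 - u b / M) *\<^sub>R b) = \<Sum>B - (1 / M) *\<^sub>R w"
      by (simp add: u scaleR_left_diff_distrib sum_subtractf scaleR_sum_right)
    finally show ?thesis
      using \<open>M > 0\<close> by (intro exI[of _ "1 / M"]) auto
  qed
  moreover have "\<Sum>B \<in> K"
    using comb[of B "\<lambda>_. 1"] by simp
  ultimately have "\<Sum>B \<in> rel_interior K"
    using mem_rel_interior_convex_cone[OF K F] by blast
  then show ?thesis by blast
qed

text \<open>
  This is what carries the partition set \<open>R\<^sup>0\<close> from one program to the other. For the nontrivial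
  inclusion, a relative interior point of the image stays in the image after subtracting a small
  multiple of \<open>f v0\<close>, where \<open>v0\<close> is a relative interior point of \<open>K\<close>. Lift the difference to
  \<open>u \<in> K\<close>; adding the multiple of \<open>v0\<close> back gives a lift in the relative interior.
\<close>

lemma rel_interior_linear_image_convex_cone:
  fixes K :: "'a::real_inner set" and f :: "'a \<Rightarrow> 'b::real_inner"
  assumes K: "convex_cone K" and F: "K \<subseteq> span F" "finite F" and f: "linear f"
  shows "rel_interior (f ` K) = f ` rel_interior K"
proof -
  have fK: "convex_cone (f ` K)"
    using K f convex_cone_linear_image by blast
  have fF: "f ` K \<subseteq> span (f ` F)" "finite (f ` F)"
    using F linear_span_image[OF f] by auto
  note ri = mem_rel_interior_convex_cone[OF K F] and rif = mem_rel_interior_convex_cone[OF fK fF]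
  note lin = linear_add[OF f] linear_diff[OF f] linear_scale[OF f]
  show ?thesis
  proof safe
    fix v' assume v': "v' \<in> rel_interior (f ` K)"
    obtain v0 where v0: "v0 \<in> rel_interior K"
      using rel_interior_convex_cone_nonempty[OF K F] by blast
    then obtain \<epsilon> where \<epsilon>: "\<epsilon> > 0" "v' - \<epsilon> *\<^sub>R f v0 \<in> f ` K"
      using v' rif ri by blast
    then obtain u where u: "u \<in> K" "v' - \<epsilon> *\<^sub>R f v0 = f u"
      by blast
    have "u + \<epsilon> *\<^sub>R v0 \<in> rel_interior K"
      unfolding ri
    proof (intro conjI ballI)
      show "u + \<epsilon> *\<^sub>R v0 \<in> K"
        using u(1) v0 \<epsilon>(1) ri K by (auto simp: convex_cone_iff)
      fix w assume "w \<in> K"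
      then obtain \<eta> where \<eta>: "\<eta> > 0" "v0 - \<eta> *\<^sub>R w \<in> K"
        using v0 ri by blast
      then have "u + \<epsilon> *\<^sub>R (v0 - \<eta> *\<^sub>R w) \<in> K"
        using u(1) \<epsilon>(1) K by (auto simp: convex_cone_iff)
      then show "\<exists>\<eta>>0. u + \<epsilon> *\<^sub>R v0 - \<eta> *\<^sub>R w \<in> K"
        using \<epsilon>(1) \<eta>(1) by (intro exI[of _ "\<epsilon> * \<eta>"]) (auto simp: algebra_simps)
    qed
    moreover have "v' = f (u + \<epsilon> *\<^sub>R v0)"
      using u(2) by (simp add: lin algebra_simps)
    ultimately show "v' \<in> f ` rel_interior K"
      by blast
  next
    fix v assume v: "v \<in> rel_interior K"
    show "f v \<in> rel_interior (f ` K)"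
      unfolding rif
    proof (intro conjI ballI)
      show "f v \<in> f ` K" using v ri by blast
      fix w' assume "w' \<in> f ` K"
      then obtain w where w: "w \<in> K" "w' = f w" by blast
      then obtain \<epsilon> where "\<epsilon> > 0" "v - \<epsilon> *\<^sub>R w \<in> K"
        using v ri by blast
      moreover from this have "f v - \<epsilon> *\<^sub>R w' \<in> f ` K"
        unfolding w(2) by (metis lin(2,3) imageI)
      ultimately show "\<exists>\<epsilon>>0. f v - \<epsilon> *\<^sub>R w' \<in> f ` K" by blast
    qed
  qed
qed

text \<open>
  The hypothesis says that \<open>e\<close> is uniformly positive on \<open>G\<close>, so that it absorbs every small
  perturbation. It reduces interiors to membership along the single direction \<open>e\<close>, which will be
  the identity matrix or the axis of the Lorentz cone.
\<close>

lemma int_in_dual_cone: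
  fixes G :: "'a::real_inner set"
  assumes E: "subspace E" "e \<in> E" and \<kappa>: "\<kappa> > 0" "\<And>z. z \<in> G \<Longrightarrow> \<kappa> * norm z \<le> e \<bullet> z"
  shows "y \<in> int_in E (dual_cone E G) \<longleftrightarrow> (\<exists>\<epsilon>>0. y - \<epsilon> *\<^sub>R e \<in> dual_cone E G)"
proof
  assume "y \<in> int_in E (dual_cone E G)"
  then obtain T where T: "open T" "y \<in> T" "y \<in> E" "T \<inter> E \<subseteq> dual_cone E G"
    by (auto simp: int_in_def interior_of_def openin_open)
  obtain d where d: "d > 0" "ball y d \<subseteq> T"
    using T(1,2) open_contains_ball by blast
  define \<epsilon> where "\<epsilon> = d / (1 + norm e)"
  have "1 + norm e > 0"
    by (simp add: add_pos_nonneg)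
  then have "\<epsilon> > 0" "\<epsilon> * norm e < d"
    using d(1) by (auto simp: \<epsilon>_def field_simps)
  then have "y - \<epsilon> *\<^sub>R e \<in> T"
    using d(2) by (auto simp: dist_norm subset_iff)
  moreover have "y - \<epsilon> *\<^sub>R e \<in> E"
    using E T(3) by (intro subspace_diff subspace_scale)
  ultimately show "\<exists>\<epsilon>>0. y - \<epsilon> *\<^sub>R e \<in> dual_cone E G"
    using T(4) \<open>\<epsilon> > 0\<close> by blast
next
  assume "\<exists>\<epsilon>>0. y - \<epsilon> *\<^sub>R e \<in> dual_cone E G"
  then obtain \<epsilon> where \<epsilon>: "\<epsilon> > 0" "y - \<epsilon> *\<^sub>R e \<in> E" "\<And>z. z \<in> G \<Longrightarrow> 0 \<le> (y - \<epsilon> *\<^sub>R e) \<bullet> z"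
    by (auto simp: dual_cone_def)
  have "(y - \<epsilon> *\<^sub>R e) + \<epsilon> *\<^sub>R e \<in> E"
    using \<epsilon>(2) E by (intro subspace_add subspace_scale)
  then have y: "y \<in> E" by simp
  have "w \<in> dual_cone E G" if w: "w \<in> ball y (\<epsilon> * \<kappa>)" "w \<in> E" for w
  proof -
    have "0 \<le> w \<bullet> z" if z: "z \<in> G" for z
    proof -
      have "\<bar>(w - y) \<bullet> z\<bar> \<le> norm (w - y) * norm z"
        by (rule Cauchy_Schwarz_ineq2)
      also have "\<dots> \<le> (\<epsilon> * \<kappa>) * norm z"
        using w(1) by (intro mult_right_mono) (auto simp: dist_norm norm_minus_commute)
      also have "\<dots> \<le> \<epsilon> * (e \<bullet> z)"
        using \<kappa>(2)[OF z] \<epsilon>(1) by simp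
      finally show ?thesis
        using \<epsilon>(3)[OF z] by (simp add: inner_diff_left)
    qed
    then show ?thesis
      using w(2) by (simp add: dual_cone_def)
  qed
  then show "y \<in> int_in E (dual_cone E G)"
    using y \<epsilon>(1) \<kappa>(1)
    unfolding int_in_def interior_of_def
    by (auto intro!: exI[of _ "E \<inter> ball y (\<epsilon> * \<kappa>)"] openin_open_Int)
qed

section \<open>Normal cones and finite-dimensional supports\<close>

lemma span_finite_support:
  fixes X :: "'i \<Rightarrow>\<^sub>0 real"
  assumes "finite I" "keys X \<subseteq> I"
  shows "X \<in> span ((\<lambda>i. Poly_Mapping.single i 1) ` I)"
proof -
  have "X = (\<Sum>i\<in>I. lookup X i *\<^sub>R Poly_Mapping.single i 1)"
    using assms
    by (intro poly_mapping_eqI)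
      (auto simp: lookup_sum scaleR_poly_mapping.rep_eq lookup_single when_def in_keys_iff subset_iff
        if_distrib[of "(*) _"] cong: if_cong)
  also have "\<dots> \<in> span ((\<lambda>i. Poly_Mapping.single i 1) ` I)"
    by (intro span_sum span_scale span_base imageI)
  finally show ?thesis .
qed

text \<open>
  For a cone, the normal cone at \<open>s\<close> is the negative of the face of the dual cone orthogonal
  to \<open>s\<close>; testing with \<open>0\<close> and \<open>2 s\<close> shows the orthogonality.
\<close>

lemma convex_cone_normal_cone:
  assumes "subspace E" "s \<in> Q" "convex_cone Q"
  shows "normal_cone E Q s = {v\<in>E. - v \<in> dual_cone E Q \<and> v \<bullet> s = 0}"
    and "convex_cone (normal_cone E Q s)"
proof -
  have Q: "0 \<in> Q" "\<And>x y. x \<in> Q \<Longrightarrow> y \<in> Q \<Longrightarrow> x + y \<in> Q"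
    using assms(3) by (auto simp: convex_cone_iff)
  show eq: "normal_cone E Q s = {v\<in>E. - v \<in> dual_cone E Q \<and> v \<bullet> s = 0}"
  proof (intro set_eqI iffI; clarsimp)
    fix v assume v: "v \<in> normal_cone E Q s"
    then have vE: "v \<in> E" and le: "\<And>z. z \<in> Q \<Longrightarrow> v \<bullet> z \<le> v \<bullet> s"
      by (auto simp: normal_cone_def inner_diff_right)
    have "v \<bullet> s = 0"
      using le[OF Q(1)] le[OF Q(2)[OF assms(2) assms(2)]] by (simp add: inner_add_right)
    then show "v \<in> E \<and> - v \<in> dual_cone E Q \<and> v \<bullet> s = 0"
      using vE le subspace_neg[OF assms(1) vE] by (auto simp: dual_cone_def)
  next
    fix v assume "v \<in> E" "- v \<in> dual_cone E Q" "v \<bullet> s = 0"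
    then show "v \<in> normal_cone E Q s"
      by (auto simp: dual_cone_def normal_cone_def inner_diff_right)
  qed
  show "convex_cone (normal_cone E Q s)"
    unfolding convex_cone_iff eq
    using subspace_0[OF assms(1)] subspace_add[OF assms(1)] subspace_scale[OF assms(1)]
      subspace_neg[OF assms(1)] subspace_diff[OF assms(1)]
    by (auto simp: dual_cone_def inner_add_left inner_left_distrib mult_nonneg_nonpos
        simp flip: mult_minus_right intro!: add_nonpos_nonpos)
qed

lemma convex_cone_dual_cone: "subspace E \<Longrightarrow> convex_cone (dual_cone E G)"
  unfolding convex_cone_iff
  by (auto simp: dual_cone_def inner_add_left subspace_0 subspace_add subspace_scale)

section \<open>The arrow map and its adjoint\<close>

definition outer :: "nat \<Rightarrow> (nat \<Rightarrow> real) \<Rightarrow> (nat \<times> nat \<Rightarrow>\<^sub>0 real)"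
  where "outer m v = tabulate ({..m} \<times> {..m}) (\<lambda>(i, k). v i * v k)"

definition arw_adj :: "nat \<Rightarrow> (nat \<times> nat \<Rightarrow>\<^sub>0 real) \<Rightarrow> (nat \<Rightarrow>\<^sub>0 real)"
  where "arw_adj m Y = tabulate {..m}
    (\<lambda>i. if i = 0 then (\<Sum>k\<le>m. lookup Y (k, k)) else 2 * lookup Y (0, i))"

text \<open>
  The axis vector \<open>(1, 0)\<close>; its arrow matrix \<open>arw m e0\<close> is the identity.
\<close>

definition e0 :: "nat \<Rightarrow>\<^sub>0 real"
  where "e0 = Poly_Mapping.single 0 1"

lemma lookup_e0: "lookup e0 i = (if i = 0 then 1 else 0)"
  by (simp add: e0_def lookup_single when_def del: single_one)

lemma keys_tabulate: "finite I \<Longrightarrow> keys (tabulate I f) \<subseteq> I"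
  by (auto simp: in_keys_iff lookup_tabulate split: if_splits)

lemma arw_in_sym_space: "arw m s \<in> sym_space m"
  using keys_tabulate[of "{..m} \<times> {..m}"]
  by (auto simp: sym_space_def arw_def lookup_tabulate)

lemma outer_in_sym_space: "outer m v \<in> sym_space m"
  using keys_tabulate[of "{..m} \<times> {..m}"]
  by (auto simp: sym_space_def outer_def lookup_tabulate)

lemma arw_adj_in_vec_space: "arw_adj m Y \<in> vec_space m"
  using keys_tabulate[of "{..m}"] by (auto simp: vec_space_def arw_adj_def)

lemma e0_in_vec_space: "e0 \<in> vec_space m"
  by (auto simp: vec_space_def in_keys_iff lookup_e0 split: if_splits)

lemma linear_arw_adj: "linear (arw_adj m)"
  by (rule linearI; rule poly_mapping_eqI)
    (auto simp: arw_adj_def lookup_tabulate lookup_add scaleR_poly_mapping.rep_eq sum.distrib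
      sum_distrib_left)

lemma sum_atMost_head: "(\<Sum>i\<le>m. f i) = f 0 + (\<Sum>i=1..m. f i)" for f :: "nat \<Rightarrow> real"
  by (simp add: atMost_atLeast0 sum.atLeast_Suc_atMost)

lemma inner_vec_space:
  assumes "s \<in> vec_space m"
  shows "s \<bullet> t = lookup s 0 * lookup t 0 + (\<Sum>i=1..m. lookup s i * lookup t i)"
  using assms inner_poly_mapping_superset[of "{..m}" s t] sum_atMost_head
  by (auto simp: vec_space_def in_keys_iff lookup_e0 split: if_splits)

lemma inner_sym_space:
  assumes "X \<in> sym_space m"
  shows "X \<bullet> Y = (\<Sum>i\<le>m. \<Sum>k\<le>m. lookup X (i, k) * lookup Y (i, k))"
proof -
  have "X \<bullet> Y = (\<Sum>p\<in>{..m} \<times> {..m}. lookup X p * lookup Y p)"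
    using assms by (subst inner_poly_mapping_superset[of "{..m} \<times> {..m}"]) (auto simp: sym_space_def)
  then show ?thesis
    by (simp add: sum.cartesian_product case_prod_unfold)
qed

lemma inner_outer:
  assumes "X \<in> sym_space m"
  shows "X \<bullet> outer m v = (\<Sum>i\<le>m. \<Sum>k\<le>m. v i * lookup X (i, k) * v k)"
  unfolding inner_sym_space[OF assms]
  by (intro sum.cong) (auto simp: outer_def lookup_tabulate)

section \<open>Lorentz and semidefinite cones\<close>

lemma psd_cone_eq_dual: "psd_cone m = dual_cone (sym_space m) (range (outer m))"
  by (auto simp: psd_cone_def dual_cone_def inner_outer)

lemma arw_adjoint:
  assumes "s \<in> vec_space m" "Y \<in> sym_space m"
  shows "arw m s \<bullet> Y = s \<bullet> arw_adj m Y"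
proof -
  have Y: "lookup Y (i, 0) = lookup Y (0, i)" for i
    using assms(2) by (auto simp: sym_space_def)
  have row: "(\<Sum>k\<le>m. lookup (arw m s) (i, k) * lookup Y (i, k)) =
      lookup s 0 * lookup Y (i, i) + lookup s i * lookup Y (0, i)" if i: "i \<in> {1..m}" for i
  proof -
    have "(\<Sum>k=1..m. lookup (arw m s) (i, k) * lookup Y (i, k)) =
        (\<Sum>k=1..m. if k = i then lookup s 0 * lookup Y (i, i) else 0)"
      using i by (intro sum.cong) (auto simp: arw_def lookup_tabulate)
    then show ?thesis
      using i by (simp add: sum_atMost_head) (simp add: arw_def lookup_tabulate Y)
  qed
  have row0: "(\<Sum>k\<le>m. lookup (arw m s) (0, k) * lookup Y (0, k)) =
      lookup s 0 * lookup Y (0, 0) + (\<Sum>k=1..m. lookup s k * lookup Y (0, k))"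
    unfolding sum_atMost_head
    by (intro arg_cong2[of _ _ _ _ "(+)"] sum.cong) (auto simp: arw_def lookup_tabulate)
  have "arw m s \<bullet> Y = lookup s 0 * lookup Y (0, 0) + (\<Sum>k=1..m. lookup s k * lookup Y (0, k)) +
      (\<Sum>i=1..m. lookup s 0 * lookup Y (i, i) + lookup s i * lookup Y (0, i))"
    unfolding inner_sym_space[OF arw_in_sym_space] sum_atMost_head[of "\<lambda>i. \<Sum>k\<le>m. _ i k"] row0
    using row by simp
  also have "\<dots> = s \<bullet> arw_adj m Y"
    unfolding inner_vec_space[OF assms(1)]
    by (simp add: arw_adj_def lookup_tabulate sum_atMost_head sum.distrib sum_distrib_left
        algebra_simps)
  finally show ?thesis .
qed

lemma L2_set_square: "(\<Sum>i\<in>A. f i * f i) = (L2_set f A)\<^sup>2"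
  by (simp add: L2_set_def sum_nonneg power2_eq_square)

text \<open>
  Writing \<open>w\<close> for the tail of \<open>v\<close>, the image of the matrix of all products \<open>v\<^sub>i v\<^sub>k\<close> is
  \<open>(v\<^sub>0\<^sup>2 + \<parallel>w\<parallel>\<^sup>2, 2 v\<^sub>0 w)\<close>, the square of \<open>v\<close> in the Jordan algebra of the Lorentz cone. It lies
  in the cone since \<open>2 \<bar>v\<^sub>0\<bar> \<parallel>w\<parallel> \<le> v\<^sub>0\<^sup>2 + \<parallel>w\<parallel>\<^sup>2\<close>. To write \<open>y\<close> as such a square, \<open>a = v\<^sub>0\<^sup>2\<close>
  has to solve \<open>a + N\<^sup>2 / (4 a) = y\<^sub>0\<close>, where \<open>N\<close> is the norm of the tail of \<open>y\<close>; the larger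
  root is taken.
\<close>

lemma lorentz_cone_eq_outer: "lorentz_cone m = arw_adj m ` range (outer m)"
proof (intro set_eqI iffI)
  fix y assume "y \<in> lorentz_cone m"
  then have y: "y \<in> vec_space m" "L2_set (lookup y) {1..m} \<le> lookup y 0"
    by (auto simp: lorentz_cone_def)
  define N where "N = L2_set (lookup y) {1..m}"
  define D where "D = sqrt ((lookup y 0)\<^sup>2 - N\<^sup>2)"
  define a where "a = (lookup y 0 + D) / 2"
  define v where "v i = (if i = 0 then sqrt a else lookup y i / (2 * sqrt a))" for i :: nat
  have "0 \<le> N" "N \<le> lookup y 0"
    using y(2) by (auto simp: N_def)
  then have "N\<^sup>2 \<le> (lookup y 0)\<^sup>2"
    by (intro power_mono)
  then have D: "D \<ge> 0" "D\<^sup>2 = (lookup y 0)\<^sup>2 - N\<^sup>2"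
    by (auto simp: D_def)
  have a: "a \<ge> 0"
    using D(1) \<open>0 \<le> N\<close> \<open>N \<le> lookup y 0\<close> by (simp add: a_def)
  have quad: "4 * a * a + N\<^sup>2 = 4 * a * lookup y 0"
    using D(2) by (simp add: a_def power2_eq_square field_simps)
  \<comment> \<open>\<open>a = 0\<close> forces \<open>y = 0\<close>, and division by zero then yields \<open>v = 0\<close>.\<close>
  have v: "a + N\<^sup>2 / (4 * a) = lookup y 0 \<and> (\<forall>i\<in>{1..m}. 2 * (v 0 * v i) = lookup y i)"
  proof (cases "a = 0")
    case True
    then have "lookup y 0 = 0" "N = 0"
      using D(1) \<open>0 \<le> N\<close> \<open>N \<le> lookup y 0\<close> by (auto simp: a_def)
    then show ?thesis
      using True by (auto simp: v_def N_def L2_set_eq_0_iff)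
  next
    case False
    then show ?thesis
      using a quad by (auto simp: v_def field_simps)
  qed
  have "(\<Sum>k\<le>m. v k * v k) = a + (\<Sum>k=1..m. (lookup y k)\<^sup>2 / (4 * a))"
    unfolding sum_atMost_head using a
    by (intro arg_cong2[of _ _ _ _ "(+)"] sum.cong)
      (auto simp: v_def power2_eq_square field_simps)
  also have "\<dots> = lookup y 0"
    using v by (simp add: N_def power2_eq_square[of "lookup y _"] L2_set_square flip: sum_divide_distrib)
  finally have "arw_adj m (outer m v) = y"
    using v y(1)
    by (intro poly_mapping_eqI)
      (auto simp: arw_adj_def outer_def lookup_tabulate vec_space_def in_keys_iff subset_iff)
  then show "y \<in> arw_adj m ` range (outer m)"
    by blast
next
  fix y assume "y \<in> arw_adj m ` range (outer m)"
  then obtain v where v: "y = arw_adj m (outer m v)"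
    by blast
  define N where "N = L2_set v {1..m}"
  have "L2_set (lookup y) {1..m} = L2_set (\<lambda>i. (2 * \<bar>v 0\<bar>) * v i) {1..m}"
    unfolding L2_set_def
    by (intro arg_cong[of _ _ sqrt] sum.cong)
      (auto simp: v arw_adj_def outer_def lookup_tabulate power_mult_distrib)
  also have "\<dots> = 2 * \<bar>v 0\<bar> * N"
    by (subst L2_set_right_distrib[symmetric]) (auto simp: N_def)
  also have "\<dots> \<le> \<bar>v 0\<bar>\<^sup>2 + N\<^sup>2"
    using sum_squares_bound[of "\<bar>v 0\<bar>" N] by simp
  also have "\<dots> = v 0 * v 0 + (\<Sum>k=1..m. v k * v k)"
    by (simp add: N_def L2_set_square power2_eq_square[of "v 0"])
  also have "\<dots> = lookup y 0"
    by (simp add: v arw_adj_def outer_def lookup_tabulate sum_atMost_head)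
  finally show "y \<in> lorentz_cone m"
    using arw_adj_in_vec_space by (simp add: lorentz_cone_def v)
qed

text \<open>
  Cauchy-Schwarz gives one inclusion; the other one tests \<open>y\<close> against its reflection
  \<open>(N, - y)\<close>, with \<open>N\<close> the norm of the tail.
\<close>

lemma lorentz_self_dual: "dual_cone (vec_space m) (lorentz_cone m) = lorentz_cone m"
proof (intro set_eqI iffI)
  fix y assume y: "y \<in> lorentz_cone m"
  have "0 \<le> y \<bullet> z" if z: "z \<in> lorentz_cone m" for z
  proof -
    have "\<bar>\<Sum>i=1..m. lookup y i * lookup z i\<bar> \<le> (\<Sum>i=1..m. \<bar>lookup y i\<bar> * \<bar>lookup z i\<bar>)"
      using sum_abs[of "\<lambda>i. lookup y i * lookup z i" "{1..m}"] by (simp add: abs_mult)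
    also have "\<dots> \<le> L2_set (lookup y) {1..m} * L2_set (lookup z) {1..m}"
      by (rule L2_set_mult_ineq)
    also have "\<dots> \<le> lookup y 0 * lookup z 0"
      using y z order_trans[OF L2_set_nonneg[of "lookup y" "{1..m}"]]
      by (intro mult_mono) (auto simp: lorentz_cone_def)
    finally show ?thesis
      using y by (simp add: inner_vec_space[of y m] lorentz_cone_def)
  qed
  then show "y \<in> dual_cone (vec_space m) (lorentz_cone m)"
    using y by (simp add: dual_cone_def lorentz_cone_def)
next
  fix y assume "y \<in> dual_cone (vec_space m) (lorentz_cone m)"
  then have y: "y \<in> vec_space m" "\<And>z. z \<in> lorentz_cone m \<Longrightarrow> 0 \<le> y \<bullet> z"
    by (auto simp: dual_cone_def)
  define N where "N = L2_set (lookup y) {1..m}"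
  define z where "z = tabulate {..m} (\<lambda>i. if i = 0 then N else - lookup y i)"
  have z: "lookup z 0 = N" "\<And>i. i \<in> {1..m} \<Longrightarrow> lookup z i = - lookup y i"
    by (auto simp: z_def lookup_tabulate)
  have "L2_set (lookup z) {1..m} = N"
    unfolding N_def L2_set_def by (intro arg_cong[of _ _ sqrt] sum.cong) (auto simp: z)
  then have "z \<in> lorentz_cone m"
    using z(1) keys_tabulate[of "{..m}"] by (auto simp: lorentz_cone_def vec_space_def z_def)
  then have "0 \<le> y \<bullet> z"
    by (rule y(2))
  also have "y \<bullet> z = lookup y 0 * N - N\<^sup>2"
    unfolding inner_vec_space[OF y(1)] using z
    by (simp add: N_def L2_set_square sum_negf)
  finally have ineq: "N * N \<le> lookup y 0 * N"
    by (simp add: power2_eq_square)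
  have "e0 \<in> lorentz_cone m"
    by (simp add: lorentz_cone_def e0_in_vec_space L2_set_def lookup_e0)
  then have "0 \<le> lookup y 0"
    using y(2)[of e0] by (simp add: inner_vec_space[OF y(1)] lookup_e0)
  moreover have "N \<ge> 0"
    by (simp add: N_def)
  ultimately have "N \<le> lookup y 0"
    using ineq by (cases "N = 0") (auto simp: mult_le_cancel_right)
  then show "y \<in> lorentz_cone m"
    using y(1) by (simp add: lorentz_cone_def N_def)
qed

text \<open>
  By the adjoint identity, testing \<open>arw m s\<close> against rank-one matrices is testing \<open>s\<close> against
  the Lorentz cone.
\<close>

lemma arw_in_psd_cone:
  assumes "s \<in> vec_space m"
  shows "arw m s \<in> psd_cone m \<longleftrightarrow> s \<in> lorentz_cone m"
proof -
  have "arw m s \<in> psd_cone m \<longleftrightarrow> s \<in> dual_cone (vec_space m) (lorentz_cone m)"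
    using assms outer_in_sym_space
    by (auto simp: psd_cone_eq_dual lorentz_cone_eq_outer dual_cone_def arw_in_sym_space
        arw_adjoint)
  then show ?thesis
    by (simp add: lorentz_self_dual)
qed

abbreviation psd_dual :: "nat \<Rightarrow> (nat \<times> nat \<Rightarrow>\<^sub>0 real) set"
  where "psd_dual m \<equiv> dual_cone (sym_space m) (psd_cone m)"

lemma outer_in_psd_cone: "outer m v \<in> psd_cone m"
proof -
  have "outer m v \<bullet> outer m w = (\<Sum>i\<le>m. v i * w i)\<^sup>2" for w
    unfolding inner_outer[OF outer_in_sym_space] power2_eq_square sum_product
    by (intro sum.cong) (auto simp: outer_def lookup_tabulate)
  then show ?thesis
    by (simp add: psd_cone_eq_dual dual_cone_def outer_in_sym_space)
qed

lemma outer_in_psd_dual: "outer m v \<in> psd_dual m"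
  by (auto simp: dual_cone_def psd_cone_eq_dual outer_in_sym_space inner_commute)

lemma psd_dual_subset_psd_cone: "psd_dual m \<subseteq> psd_cone m"
  using outer_in_psd_cone unfolding psd_cone_eq_dual by (auto simp: dual_cone_def)

text \<open>
  Every multiplier of the second-order cone program lifts to one of the semidefinite program,
  and a rank-one lift suffices.
\<close>

lemma arw_adj_psd_dual: "arw_adj m ` psd_dual m = lorentz_cone m"
proof
  show "lorentz_cone m \<subseteq> arw_adj m ` psd_dual m"
    unfolding lorentz_cone_eq_outer using outer_in_psd_dual by auto
  have "arw_adj m Y \<in> dual_cone (vec_space m) (lorentz_cone m)" if "Y \<in> psd_dual m" for Y
    using that arw_in_psd_cone arw_adj_in_vec_space
    by (auto simp: dual_cone_def inner_commute[of "arw_adj m Y"] lorentz_cone_def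
        arw_adjoint[symmetric] inner_commute[of "arw m _"])
  then show "arw_adj m ` psd_dual m \<subseteq> lorentz_cone m"
    by (auto simp: lorentz_self_dual)
qed

lemma arw_adj_arw_e0: "arw_adj m (arw m e0) = real (m + 1) *\<^sub>R e0"
  by (intro poly_mapping_eqI)
    (auto simp: arw_adj_def arw_def lookup_tabulate scaleR_poly_mapping.rep_eq lookup_e0)

section \<open>Interiors and relative interiors under lifting\<close>

text \<open>
  Every entry of a positive semidefinite matrix is bounded by the mean of two diagonal entries;
  \<open>arw m e0 \<bullet> W\<close> is the trace.
\<close>

lemma norm_le_trace:
  assumes "W \<in> psd_cone m"
  shows "norm W \<le> real (m + 1) * (arw m e0 \<bullet> W)"
proof -
  have W: "W \<in> sym_space m" "\<And>v. 0 \<le> (\<Sum>i\<le>m. \<Sum>k\<le>m. v i * lookup W (i, k) * v k)"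
    using assms by (auto simp: psd_cone_def)
  have sym: "lookup W (i, k) = lookup W (k, i)" for i k
    using W(1) by (auto simp: sym_space_def)
  have entry: "\<bar>lookup W (i, k)\<bar> \<le> (lookup W (i, i) + lookup W (k, k)) / 2" if "i \<le> m" "k \<le> m" for i k
  proof -
    have "0 \<le> lookup W (i, i) + \<sigma> * (lookup W (i, k) + lookup W (k, i)) + \<sigma>\<^sup>2 * lookup W (k, k)" for \<sigma> :: real
    proof -
      define v :: "nat \<Rightarrow> real"
        where "v l = (if l = i then 1 else 0) + \<sigma> * (if l = k then 1 else 0)" for l
      have "(\<Sum>l\<le>m. v l * f l) = f i + \<sigma> * f k" for f
        using that by (simp add: v_def distrib_right sum.distrib if_distrib[of "\<lambda>x. x * _"]
          mult.assoc sum_distrib_left[symmetric] cong: if_cong)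
      note v = this
      have "(\<Sum>j\<le>m. \<Sum>l\<le>m. v j * lookup W (j, l) * v l) =
          (\<Sum>j\<le>m. v j * (\<Sum>l\<le>m. v l * lookup W (j, l)))"
        by (simp add: sum_distrib_left mult_ac)
      also have "\<dots> = lookup W (i, i) + \<sigma> * (lookup W (i, k) + lookup W (k, i)) + \<sigma>\<^sup>2 * lookup W (k, k)"
        unfolding v by (simp add: algebra_simps power2_eq_square)
      finally show ?thesis
        using W(2)[of v] by simp
    qed
    from this[of 1] this[of "-1"] show ?thesis
      using sym[of k i] by (simp add: abs_le_iff field_simps)
  qed
  have "norm W = L2_set (lookup W) ({..m} \<times> {..m})"
    using W(1) by (simp add: norm_poly_mapping_def L2_set_def inner_sym_space sum.cartesian_product
        case_prod_unfold power2_eq_square)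
  also have "\<dots> \<le> (\<Sum>p\<in>{..m} \<times> {..m}. \<bar>lookup W p\<bar>)"
    by (rule L2_set_le_sum_abs)
  also have "\<dots> = (\<Sum>i\<le>m. \<Sum>k\<le>m. \<bar>lookup W (i, k)\<bar>)"
    by (simp add: sum.cartesian_product case_prod_unfold)
  also have "\<dots> \<le> (\<Sum>i\<le>m. \<Sum>k\<le>m. (lookup W (i, i) + lookup W (k, k)) / 2)"
    using entry by (intro sum_mono) auto
  also have "\<dots> = (\<Sum>i\<le>m. (real (m + 1) * lookup W (i, i) + (\<Sum>k\<le>m. lookup W (k, k))) / 2)"
    by (intro sum.cong) (simp_all add: sum.distrib flip: sum_divide_distrib)
  also have "\<dots> = real (m + 1) * (\<Sum>k\<le>m. lookup W (k, k))"
    by (simp add: sum.distrib flip: sum_divide_distrib sum_distrib_left)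
  also have "(\<Sum>k\<le>m. lookup W (k, k)) = arw m e0 \<bullet> W"
    using W(1) by (simp add: arw_adjoint e0_in_vec_space inner_vec_space[of e0 m])
      (simp add: arw_adj_def lookup_tabulate lookup_e0)
  finally show ?thesis .
qed

lemma norm_lorentz_le:
  assumes "z \<in> lorentz_cone m"
  shows "norm z \<le> 2 * (e0 \<bullet> z)"
proof -
  have z: "z \<in> vec_space m" "L2_set (lookup z) {1..m} \<le> lookup z 0"
    using assms by (auto simp: lorentz_cone_def)
  have nn: "0 \<le> lookup z 0"
    using z(2) L2_set_nonneg order_trans by blast
  have "z \<bullet> z = (lookup z 0)\<^sup>2 + (L2_set (lookup z) {1..m})\<^sup>2"
    by (simp add: inner_vec_space[OF z(1)] L2_set_square power2_eq_square[of "lookup z 0"])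
  also have "\<dots> \<le> (lookup z 0)\<^sup>2 + (lookup z 0)\<^sup>2"
    using z(2) by (intro add_left_mono power_mono) auto
  also have "\<dots> \<le> (2 * lookup z 0)\<^sup>2"
    by (simp add: power2_eq_square)
  finally have "norm z \<le> 2 * lookup z 0"
    using nn by (simp add: norm_poly_mapping_def real_le_lsqrt)
  then show ?thesis
    by (simp add: inner_vec_space[OF e0_in_vec_space[of m]] lookup_e0)
qed

lemma mem_int_lorentz_cone: "s \<in> int_in (vec_space m) (lorentz_cone m) \<longleftrightarrow>
    (\<exists>\<epsilon>>0. s - \<epsilon> *\<^sub>R e0 \<in> lorentz_cone m)"
proof -
  have "1 / 2 * norm z \<le> e0 \<bullet> z" if "z \<in> lorentz_cone m" for z
    using norm_lorentz_le[OF that] by simp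
  from int_in_dual_cone[OF subspace_vec_space[of m] e0_in_vec_space _ this, where y = s and G = "lorentz_cone m"] show ?thesis
    by (simp add: lorentz_self_dual)
qed

lemma norm_div_le_trace: "W \<in> psd_cone m \<Longrightarrow> 1 / real (m + 1) * norm W \<le> arw m e0 \<bullet> W"
  using norm_le_trace[of W m] by (simp add: pos_divide_le_eq mult.commute)

lemma mem_int_psd_cone: "X \<in> int_in (sym_space m) (psd_cone m) \<longleftrightarrow>
    (\<exists>\<epsilon>>0. X - \<epsilon> *\<^sub>R arw m e0 \<in> psd_cone m)"
proof -
  have "1 / real (m + 1) * norm z \<le> arw m e0 \<bullet> z" if "z \<in> range (outer m)" for z
    using norm_div_le_trace[of z m] outer_in_psd_cone that by blast
  from int_in_dual_cone[OF subspace_sym_space arw_in_sym_space _ this, where y = X] show ?thesis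
    by (simp add: psd_cone_eq_dual)
qed

lemma mem_int_psd_dual: "X \<in> int_in (sym_space m) (psd_dual m) \<longleftrightarrow>
    (\<exists>\<epsilon>>0. X - \<epsilon> *\<^sub>R arw m e0 \<in> psd_dual m)"
  using int_in_dual_cone[OF subspace_sym_space arw_in_sym_space _ norm_div_le_trace, where y = X]
  by simp

lemma arw_eq_0_iff: "s \<in> vec_space m \<Longrightarrow> arw m s = 0 \<longleftrightarrow> s = 0"
proof
  assume s: "s \<in> vec_space m" "arw m s = 0"
  have "lookup s k = lookup (arw m s) (0, k)" if "k \<le> m" for k
    using that by (auto simp: arw_def lookup_tabulate)
  then show "s = 0"
    using s by (intro poly_mapping_eqI) (auto simp: vec_space_def in_keys_iff subset_iff)
qed (simp add: linear_0[OF linear_arw])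

lemma arw_adj_eq_0:
  assumes "Y \<in> psd_dual m" "arw_adj m Y = 0"
  shows "Y = 0"
proof -
  have Y: "Y \<in> psd_cone m" "Y \<in> sym_space m"
    using assms(1) psd_dual_subset_psd_cone by (auto simp: dual_cone_def)
  then have "arw m e0 \<bullet> Y = 0"
    using assms(2) by (simp add: arw_adjoint e0_in_vec_space)
  then show ?thesis
    using norm_le_trace[OF Y(1)] by simp
qed

lemma arw_in_int_psd_cone:
  assumes "s \<in> vec_space m"
  shows "arw m s \<in> int_in (sym_space m) (psd_cone m) \<longleftrightarrow> s \<in> int_in (vec_space m) (lorentz_cone m)"
proof -
  have "arw m s - \<epsilon> *\<^sub>R arw m e0 \<in> psd_cone m \<longleftrightarrow> s - \<epsilon> *\<^sub>R e0 \<in> lorentz_cone m" for \<epsilon>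
    using arw_in_psd_cone[of "s - \<epsilon> *\<^sub>R e0" m] assms
      subspace_diff[OF subspace_vec_space assms subspace_scale[OF subspace_vec_space e0_in_vec_space]]
    by (simp add: linear_diff[OF linear_arw] linear_scale[OF linear_arw])
  then show ?thesis
    by (simp add: mem_int_psd_cone mem_int_lorentz_cone)
qed

text \<open>
  A rank-one lift is singular when \<open>m \<ge> 1\<close>. An interior \<open>y\<close> leaves room to split off a multiple
  of \<open>e0\<close>, which is lifted to a multiple of the identity instead; the factor \<open>m + 1\<close> is the trace
  of the identity.
\<close>

lemma int_lorentz_lift:
  "y \<in> int_in (vec_space m) (lorentz_cone m) \<longleftrightarrow>
    (\<exists>Y\<in>psd_dual m. arw_adj m Y = y \<and> Y \<in> int_in (sym_space m) (psd_dual m))"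
proof
  assume "y \<in> int_in (vec_space m) (lorentz_cone m)"
  then obtain \<epsilon> where \<epsilon>: "\<epsilon> > 0" "y - \<epsilon> *\<^sub>R e0 \<in> lorentz_cone m"
    by (auto simp: mem_int_lorentz_cone)
  then obtain Z where Z: "Z \<in> psd_dual m" "arw_adj m Z = y - \<epsilon> *\<^sub>R e0"
    using arw_adj_psd_dual by (metis imageE)
  define Y where "Y = Z + (\<epsilon> / real (m + 1)) *\<^sub>R arw m e0"
  have Y: "Y \<in> int_in (sym_space m) (psd_dual m)"
    unfolding mem_int_psd_dual
    using Z(1) \<epsilon>(1) by (intro exI[of _ "\<epsilon> / real (m + 1)"]) (simp add: Y_def)
  then have "Y \<in> psd_dual m"
    using interior_of_subset[of "top_of_set (sym_space m)"] unfolding int_in_def by blast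
  moreover have "arw_adj m Y = y"
    by (simp add: Y_def linear_add[OF linear_arw_adj] linear_scale[OF linear_arw_adj] Z(2)
        arw_adj_arw_e0 del: of_nat_add of_nat_Suc)
  ultimately show "\<exists>Y\<in>psd_dual m. arw_adj m Y = y \<and> Y \<in> int_in (sym_space m) (psd_dual m)"
    using Y by blast
next
  assume "\<exists>Y\<in>psd_dual m. arw_adj m Y = y \<and> Y \<in> int_in (sym_space m) (psd_dual m)"
  then obtain Y \<epsilon> where Y: "arw_adj m Y = y" "\<epsilon> > 0" "Y - \<epsilon> *\<^sub>R arw m e0 \<in> psd_dual m"
    by (auto simp: mem_int_psd_dual)
  have "arw_adj m (Y - \<epsilon> *\<^sub>R arw m e0) \<in> lorentz_cone m"
    using Y(3) arw_adj_psd_dual by blast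
  then have "y - (\<epsilon> * real (m + 1)) *\<^sub>R e0 \<in> lorentz_cone m"
    by (simp add: linear_diff[OF linear_arw_adj] linear_scale[OF linear_arw_adj] Y(1) arw_adj_arw_e0
        del: of_nat_add of_nat_Suc)
  then show "y \<in> int_in (vec_space m) (lorentz_cone m)"
    unfolding mem_int_lorentz_cone using Y(2) by (intro exI[of _ "\<epsilon> * real (m + 1)"]) simp
qed

lemma convex_cone_lorentz_cone: "convex_cone (lorentz_cone m)"
  using convex_cone_dual_cone[OF subspace_vec_space, of m "lorentz_cone m"]
  by (simp add: lorentz_self_dual)

lemma convex_cone_psd_cone: "convex_cone (psd_cone m)"
  by (simp add: psd_cone_eq_dual convex_cone_dual_cone subspace_sym_space)

lemma arw_adj_normal_cone:
  assumes s: "s \<in> lorentz_cone m"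
  shows "arw_adj m ` normal_cone (sym_space m) (psd_cone m) (arw m s) =
    normal_cone (vec_space m) (lorentz_cone m) s"
proof -
  have sv: "s \<in> vec_space m" and sp: "arw m s \<in> psd_cone m"
    using s arw_in_psd_cone by (auto simp: lorentz_cone_def)
  have orth: "V \<bullet> arw m s = arw_adj m V \<bullet> s" if "V \<in> sym_space m" for V
    using arw_adjoint[OF sv that] by (simp add: inner_commute)
  note [simp] = linear_neg[OF linear_arw_adj]
  have "arw_adj m ` {V\<in>sym_space m. - V \<in> psd_dual m \<and> V \<bullet> arw m s = 0} =
      {v\<in>vec_space m. - v \<in> lorentz_cone m \<and> v \<bullet> s = 0}" (is "?L = ?R")
  proof
    show "?L \<subseteq> ?R"
    proof safe
      fix V assume V: "V \<in> sym_space m" "- V \<in> psd_dual m" "V \<bullet> arw m s = 0"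
      have "arw_adj m (- V) \<in> lorentz_cone m"
        using V(2) arw_adj_psd_dual by blast
      then show "- arw_adj m V \<in> lorentz_cone m"
        by simp
      show "arw_adj m V \<bullet> s = 0"
        using orth[OF V(1)] V(3) by simp
    qed (rule arw_adj_in_vec_space)
    show "?R \<subseteq> ?L"
    proof safe
      fix v assume v: "v \<in> vec_space m" "- v \<in> lorentz_cone m" "v \<bullet> s = 0"
      then obtain W where W: "W \<in> psd_dual m" "arw_adj m W = - v"
        using arw_adj_psd_dual by (metis imageE)
      have WS: "- W \<in> sym_space m"
        using W(1) subspace_neg[OF subspace_sym_space] by (auto simp: dual_cone_def)
      show "v \<in> ?L"
        using WS W v(3) orth[OF WS] by (intro image_eqI[of _ _ "- W"]) auto
    qed
  qed
  then show ?thesis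
    unfolding convex_cone_normal_cone(1)[OF subspace_sym_space sp convex_cone_psd_cone]
      convex_cone_normal_cone(1)[OF subspace_vec_space s convex_cone_lorentz_cone]
      lorentz_self_dual .
qed

text \<open>
  The adjoint of \<open>arw m\<close> maps the normal cone of the semidefinite cone onto that of the Lorentz
  cone, and relative interiors commute with linear images. This treats interior, boundary and zero
  slacks uniformly.
\<close>

lemma rel_interior_normal_cone_lift:
  assumes s: "s \<in> lorentz_cone m"
  shows "- y \<in> rel_interior (normal_cone (vec_space m) (lorentz_cone m) s) \<longleftrightarrow>
    (\<exists>Y\<in>psd_dual m. arw_adj m Y = y \<and>
      - Y \<in> rel_interior (normal_cone (sym_space m) (psd_cone m) (arw m s)))"
proof -
  let ?K = "normal_cone (sym_space m) (psd_cone m) (arw m s)"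
  have sp: "arw m s \<in> psd_cone m"
    using s arw_in_psd_cone by (auto simp: lorentz_cone_def)
  note K = convex_cone_normal_cone[OF subspace_sym_space sp convex_cone_psd_cone]
  have fin: "?K \<subseteq> span ((\<lambda>p. Poly_Mapping.single p 1) ` ({..m} \<times> {..m}))"
    using span_finite_support[of "{..m} \<times> {..m}"] unfolding K(1) by (auto simp: sym_space_def)
  have ri: "rel_interior (normal_cone (vec_space m) (lorentz_cone m) s) = arw_adj m ` rel_interior ?K"
    unfolding arw_adj_normal_cone[OF s, symmetric]
    by (rule rel_interior_linear_image_convex_cone[OF K(2) fin _ linear_arw_adj]) simp
  have "- V \<in> psd_dual m" if "V \<in> rel_interior ?K" for V
    using that rel_interior_subset[of ?K] unfolding K(1) by blast
  then show ?thesis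
    unfolding ri using linear_neg[OF linear_arw_adj, of m]
    by (auto simp: image_iff) (metis minus_minus)+
qed

section \<open>Transfer of the partitions\<close>

context
  fixes r :: nat
    and n :: "nat \<Rightarrow> nat"
    and A :: "nat \<Rightarrow> nat \<Rightarrow> real^'n"
    and b :: "nat \<Rightarrow> nat \<Rightarrow> real"
    and c :: "real^'n"
begin

abbreviation "SOCP \<equiv> socp r n A b c"
abbreviation "SDP \<equiv> socp_sdp r n A b c"

lemma program_simps:
  "blocks SOCP = {1..r}" "space_of SOCP = (\<lambda>j. vec_space (n j))" "cone_of SOCP = (\<lambda>j. lorentz_cone (n j))"
  "blocks SDP = {1..r}" "space_of SDP = (\<lambda>j. sym_space (n j))" "cone_of SDP = (\<lambda>j. psd_cone (n j))"
  "cost SOCP = c" "cost SDP = c"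
  by (simp_all add: socp_def socp_sdp_def)

lemma lin_in_vec_space: "lin SOCP j x \<in> vec_space (n j)"
  using keys_tabulate[of "{..n j}"] by (auto simp: socp_def vec_space_def)

lemma slack_in_vec_space: "slack SOCP j x \<in> vec_space (n j)"
proof -
  have "rhs SOCP j \<in> vec_space (n j)"
    using keys_tabulate[of "{..n j}"] by (auto simp: socp_def vec_space_def)
  then show ?thesis
    unfolding slack_def using lin_in_vec_space subspace_diff subspace_vec_space by blast
qed

lemma slack_socp_sdp: "slack SDP j x = arw (n j) (slack SOCP j x)"
  by (simp add: slack_def linear_diff[OF linear_arw] socp_sdp_def)

lemma adjoint_lin_socp_sdp:
  assumes "Y \<in> sym_space (n j)"
  shows "adjoint (lin SDP j) Y = adjoint (lin SOCP j) (arw_adj (n j) Y)"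
proof -
  have "lin SDP j i \<bullet> Y = lin SOCP j i \<bullet> arw_adj (n j) Y" for i
    using arw_adjoint[OF lin_in_vec_space assms] by (simp add: socp_sdp_def)
  then show ?thesis
    by (simp add: adjoint_eq_Basis_sum[OF linear_lin_socp] adjoint_eq_Basis_sum[OF linear_lin_socp_sdp])
qed

lemma compl_solutions_socp_sdp:
  assumes "\<And>j. j \<in> {1..r} \<Longrightarrow> Y j \<in> psd_dual (n j)"
    and "\<And>j. j \<in> {1..r} \<Longrightarrow> y j = arw_adj (n j) (Y j)"
  shows "(x, Y) \<in> compl_solutions SDP \<longleftrightarrow> (x, y) \<in> compl_solutions SOCP"
proof -
  have sym: "Y j \<in> sym_space (n j)" if "j \<in> {1..r}" for j
    using assms(1)[OF that] by (simp add: dual_cone_def)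
  have "(\<Sum>j\<in>{1..r}. adjoint (lin SDP j) (Y j)) = (\<Sum>j\<in>{1..r}. adjoint (lin SOCP j) (y j))"
    using assms(2) sym adjoint_lin_socp_sdp by (intro sum.cong) auto
  moreover have "y j \<in> lorentz_cone (n j)" if "j \<in> {1..r}" for j
    using assms(1)[OF that] assms(2)[OF that] arw_adj_psd_dual by blast
  moreover have "slack SDP j x \<in> psd_cone (n j) \<longleftrightarrow> slack SOCP j x \<in> lorentz_cone (n j)" for j
    by (simp add: slack_socp_sdp arw_in_psd_cone slack_in_vec_space)
  moreover have "Y j \<bullet> slack SDP j x = y j \<bullet> slack SOCP j x" if "j \<in> {1..r}" for j
    using assms(2)[OF that] arw_adjoint[OF slack_in_vec_space sym[OF that]]
    by (simp add: slack_socp_sdp inner_commute)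
  ultimately show ?thesis
    using assms(1) by (auto simp: compl_solutions_def program_simps lorentz_self_dual)
qed

lemma feasible_slack_and_lift:
  assumes "(x, y) \<in> compl_solutions SOCP" "j \<in> {1..r}"
  shows "slack SOCP j x \<in> lorentz_cone (n j)" "\<exists>V\<in>psd_dual (n j). arw_adj (n j) V = y j"
proof -
  show "slack SOCP j x \<in> lorentz_cone (n j)"
    using assms by (auto simp: compl_solutions_def program_simps)
  have "y j \<in> lorentz_cone (n j)"
    using assms by (auto simp: compl_solutions_def program_simps lorentz_self_dual)
  then show "\<exists>V\<in>psd_dual (n j). arw_adj (n j) V = y j"
    using arw_adj_psd_dual by (metis imageE)
qed

text \<open>
  All five partition sets are existence statements about one block \<open>j\<close> of a solution, or
  complements of such. The lifts of different blocks are independent, so it suffices to lift the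
  multiplier of block \<open>j\<close> with the desired property.
\<close>

lemma ex_compl_solutions_transfer:
  assumes j: "j \<in> {1..r}"
    and iff: "\<And>x y. (x, y) \<in> compl_solutions SOCP \<Longrightarrow>
      \<Phi> x (y j) \<longleftrightarrow> (\<exists>V\<in>psd_dual (n j). arw_adj (n j) V = y j \<and> \<Psi> x V)"
  shows "(\<exists>(x, y)\<in>compl_solutions SOCP. \<Phi> x (y j)) \<longleftrightarrow> (\<exists>(x, Y)\<in>compl_solutions SDP. \<Psi> x (Y j))"
proof safe
  fix x y assume xy: "(x, y) \<in> compl_solutions SOCP" "\<Phi> x (y j)"
  then obtain V where V: "V \<in> psd_dual (n j)" "arw_adj (n j) V = y j" "\<Psi> x V"
    using iff by blast
  have "\<forall>i\<in>{1..r}. \<exists>V\<in>psd_dual (n i). arw_adj (n i) V = y i"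
    using feasible_slack_and_lift(2)[OF xy(1)] by blast
  then obtain Z where Z: "\<forall>i\<in>{1..r}. Z i \<in> psd_dual (n i) \<and> arw_adj (n i) (Z i) = y i"
    by metis
  have "(x, Z(j := V)) \<in> compl_solutions SDP \<longleftrightarrow> (x, y) \<in> compl_solutions SOCP"
    using Z V(1,2) by (intro compl_solutions_socp_sdp) auto
  then show "\<exists>(x, Y)\<in>compl_solutions SDP. \<Psi> x (Y j)"
    using xy(1) V(3) by (intro bexI[of _ "(x, Z(j := V))"]) auto
next
  fix x Y assume xY: "(x, Y) \<in> compl_solutions SDP" "\<Psi> x (Y j)"
  have Y: "Y i \<in> psd_dual (n i)" if "i \<in> {1..r}" for i
    using xY(1) that by (auto simp: compl_solutions_def program_simps)
  have xy: "(x, \<lambda>i. arw_adj (n i) (Y i)) \<in> compl_solutions SOCP"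
    using compl_solutions_socp_sdp[OF Y refl] xY(1) by blast
  then have "\<Phi> x (arw_adj (n j) (Y j))"
    using iff[OF xy] Y[OF j] xY(2) by blast
  then show "\<exists>(x, y)\<in>compl_solutions SOCP. \<Phi> x (y j)"
    using xy by (intro bexI[of _ "(x, \<lambda>i. arw_adj (n i) (Y i))"]) auto
qed

lemma part_B_eq: "part_B SOCP = part_B SDP"
proof -
  have "(\<exists>(x, y)\<in>compl_solutions SOCP. slack SOCP j x \<in> int_in (vec_space (n j)) (lorentz_cone (n j))) \<longleftrightarrow>
      (\<exists>(x, Y)\<in>compl_solutions SDP. slack SDP j x \<in> int_in (sym_space (n j)) (psd_cone (n j)))"
    if "j \<in> {1..r}" for j
    using feasible_slack_and_lift(2)[OF _ that]
    by (intro ex_compl_solutions_transfer[OF that, where \<Phi> = "\<lambda>x _. _ x" and \<Psi> = "\<lambda>x _. _ x"])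
      (auto simp: slack_socp_sdp arw_in_int_psd_cone slack_in_vec_space)
  then show ?thesis
    unfolding part_B_def program_simps by (intro Collect_cong conj_cong refl)
qed

lemma part_N_eq: "part_N SOCP = part_N SDP"
proof -
  have "(\<exists>(x, y)\<in>compl_solutions SOCP. y j \<in> int_in (vec_space (n j)) (lorentz_cone (n j))) \<longleftrightarrow>
      (\<exists>(x, Y)\<in>compl_solutions SDP. Y j \<in> int_in (sym_space (n j)) (psd_dual (n j)))"
    if "j \<in> {1..r}" for j
    using int_lorentz_lift
    by (intro ex_compl_solutions_transfer[OF that, where \<Phi> = "\<lambda>_. _" and \<Psi> = "\<lambda>_. _"]) auto
  then show ?thesis
    unfolding part_N_def program_simps lorentz_self_dual by (intro Collect_cong conj_cong refl)
qed

lemma part_R0_eq: "part_R0 SOCP = part_R0 SDP"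
proof -
  have "(\<exists>(x, y)\<in>compl_solutions SOCP. - y j \<in>
        rel_interior (normal_cone (vec_space (n j)) (lorentz_cone (n j)) (slack SOCP j x))) \<longleftrightarrow>
      (\<exists>(x, Y)\<in>compl_solutions SDP. - Y j \<in>
        rel_interior (normal_cone (sym_space (n j)) (psd_cone (n j)) (slack SDP j x)))"
    if "j \<in> {1..r}" for j
    unfolding slack_socp_sdp
    by (rule ex_compl_solutions_transfer[OF that, where
        \<Phi> = "\<lambda>x v. - v \<in> rel_interior (normal_cone _ _ (slack SOCP j x))" and
        \<Psi> = "\<lambda>x V. - V \<in> rel_interior (normal_cone _ _ (arw _ (slack SOCP j x)))"])
      (rule rel_interior_normal_cone_lift[OF feasible_slack_and_lift(1)[OF _ that]])
  then show ?thesis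
    unfolding part_R0_def program_simps by (intro Collect_cong conj_cong refl)
qed

lemma part_B0_eq: "part_B0 SOCP = part_B0 SDP"
proof -
  have "(\<exists>(x, y)\<in>compl_solutions SOCP. y j \<noteq> 0) \<longleftrightarrow> (\<exists>(x, Y)\<in>compl_solutions SDP. Y j \<noteq> 0)"
    if "j \<in> {1..r}" for j
    using feasible_slack_and_lift(2)[OF _ that] arw_adj_eq_0 linear_0[OF linear_arw_adj]
    by (intro ex_compl_solutions_transfer[OF that, where \<Phi> = "\<lambda>_ v. v \<noteq> 0" and \<Psi> = "\<lambda>_ V. V \<noteq> 0"])
      metis
  then show ?thesis
    by (fastforce simp: part_B0_def program_simps)
qed

lemma part_N0_eq: "part_N0 SOCP = part_N0 SDP"
proof -
  have "(\<exists>(x, y)\<in>compl_solutions SOCP. slack SOCP j x \<noteq> 0) \<longleftrightarrow> (\<exists>(x, Y)\<in>compl_solutions SDP. slack SDP j x \<noteq> 0)"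
    if "j \<in> {1..r}" for j
    using feasible_slack_and_lift(2)[OF _ that]
    by (intro ex_compl_solutions_transfer[OF that, where \<Phi> = "\<lambda>x _. _ x" and \<Psi> = "\<lambda>x _. _ x"])
      (auto simp: slack_socp_sdp arw_eq_0_iff slack_in_vec_space)
  then show ?thesis
    by (fastforce simp: part_N0_def program_simps)
qed

end

theorem mainTheorem6:
  fixes r :: nat
    and n :: "nat \<Rightarrow> nat"
    and A :: "nat \<Rightarrow> nat \<Rightarrow> real^'n"
    and b :: "nat \<Rightarrow> nat \<Rightarrow> real"
    and c :: "real^'n"
  assumes "strong_duality (socp r n A b c)"
  shows "four_partition (socp r n A b c) = four_partition (socp_sdp r n A b c) \<and>
    six_partition (socp r n A b c) = six_partition (socp_sdp r n A b c)"
  by (simp add: four_partition_def six_partition_def part_R_def part_T_def part_B'_def part_N'_def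
      part_O_def part_C_def part_B_eq part_N_eq part_R0_eq part_B0_eq part_N0_eq program_simps)

end
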